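(* Assume $\varphi: T\to T$ is injective but not surjective. If $C_\varphi$ is bounded on $\mathcal{L}_0$, then $\{1\}\cup\mathbb{D}\subseteq\sigma_{\mathrm p}(C_\varphi)$, where $\sigma_{\mathrm p}(C_\varphi)$ is the point spectrum of $C_\varphi$ as an operator on $\mathcal{L}_0$.
   Context: $T$ is an infinite, locally finite tree (connected graph without cycles, identified with its vertex set) with a chosen root $o$, in which every vertex except possibly $o$ has degree greater than $1$. $d(v,w)$ is the number of edges of the unique path joining $v$ and $w$, and $|v|=d(o,v)$. $T^*=T\setminus\{o\}$. For $v\in T^*$, the parent $v^-$ is the neighbor of $v$ on the path from $o$ to $v$. The Lipschitz space $\mathcal{L}$ is the set of $f:T\to\mathbb{C}$ with $\sup_{v\in T^*}|f(v)-f(v^-)|<\infty$, a Banach space under $\|f\|_{\mathcal{L}}=\max\{|f(o)|,\sup_{v\in T^*}|f(v)-f(v^-)|\}$. The little Lipschitz space $\mathcal{L}_0$ is the closed subspace of $f\in\mathcal{L}$ with $\lim_{|v|\to\infty}|f(v)-f(v^-)|=0$. The composition operator is $C_\varphi f=f\circ\varphi$; it is bounded on $\mathcal{L}_0$ if it maps $\mathcal{L}_0$ into itself and is a bounded operator there. $\mathbb{D}$ is the open unit disk in $\mathbb{C}$. The point spectrum $\sigma_{\mathrm p}(A)$ is the set of eigenvalues of $A$. *)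

theory Defs
  imports "HOL-Analysis.Analysis"
begin

text \<open>
  Simple graphs are adjacency relations \<open>E\<close> whose vertex set is the whole type \<open>'a\<close>.
  (Representing undirected graphs by symmetric digraphs and using \<open>tree\<close> of the AFP entry
  Graph Theory would not work, since there \<open>a, b, a\<close> counts as a cycle.)
\<close>

definition simple_graph :: "('a \<Rightarrow> 'a \<Rightarrow> bool) \<Rightarrow> bool" where
  "simple_graph E \<longleftrightarrow> symp E \<and> irreflp E"

definition path_between :: "('a \<Rightarrow> 'a \<Rightarrow> bool) \<Rightarrow> 'a \<Rightarrow> 'a list \<Rightarrow> 'a \<Rightarrow> bool" where
  "path_between E u p v \<longleftrightarrow>
     p \<noteq> [] \<and> hd p = u \<and> last p = v \<and> successively E p \<and> distinct p"

definition graph_connected :: "('a \<Rightarrow> 'a \<Rightarrow> bool) \<Rightarrow> bool" where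
  "graph_connected E \<longleftrightarrow> (\<forall>u v. \<exists>p. path_between E u p v)"

text \<open>A cycle is listed without repeating its first vertex at the end.\<close>

definition graph_cycle :: "('a \<Rightarrow> 'a \<Rightarrow> bool) \<Rightarrow> 'a list \<Rightarrow> bool" where
  "graph_cycle E p \<longleftrightarrow>
     length p \<ge> 3 \<and> distinct p \<and> successively E p \<and> E (last p) (hd p)"

definition graph_tree :: "('a \<Rightarrow> 'a \<Rightarrow> bool) \<Rightarrow> bool" where
  "graph_tree E \<longleftrightarrow> simple_graph E \<and> graph_connected E \<and> (\<nexists>p. graph_cycle E p)"

definition neighbors :: "('a \<Rightarrow> 'a \<Rightarrow> bool) \<Rightarrow> 'a \<Rightarrow> 'a set" where
  "neighbors E v = {w. E v w}"

definition locally_finite_graph :: "('a \<Rightarrow> 'a \<Rightarrow> bool) \<Rightarrow> bool" where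
  "locally_finite_graph E \<longleftrightarrow> (\<forall>v. finite (neighbors E v))"

definition vertex_degree :: "('a \<Rightarrow> 'a \<Rightarrow> bool) \<Rightarrow> 'a \<Rightarrow> nat" where
  "vertex_degree E v = card (neighbors E v)"

text \<open>
  The following notions, down to \<open>parent\<close>, are meaningful only for trees, where the path
  joining two vertices is unique. The number of edges of a path is one less than the
  length of its list of vertices.
\<close>

definition the_path :: "('a \<Rightarrow> 'a \<Rightarrow> bool) \<Rightarrow> 'a \<Rightarrow> 'a \<Rightarrow> 'a list" where
  "the_path E u v = (THE p. path_between E u p v)"

definition tree_dist :: "('a \<Rightarrow> 'a \<Rightarrow> bool) \<Rightarrow> 'a \<Rightarrow> 'a \<Rightarrow> nat" where
  "tree_dist E u v = length (the_path E u v) - 1"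

definition level :: "('a \<Rightarrow> 'a \<Rightarrow> bool) \<Rightarrow> 'a \<Rightarrow> 'a \<Rightarrow> nat" where
  "level E r v = tree_dist E r v"

text \<open>The parent is unspecified at the root \<open>r\<close>.\<close>

definition parent :: "('a \<Rightarrow> 'a \<Rightarrow> bool) \<Rightarrow> 'a \<Rightarrow> 'a \<Rightarrow> 'a" where
  "parent E r v = (THE w. w \<in> neighbors E v \<and> w \<in> set (the_path E r v))"

definition lipschitz_space :: "('a \<Rightarrow> 'a \<Rightarrow> bool) \<Rightarrow> 'a \<Rightarrow> ('a \<Rightarrow> complex) set" where
  "lipschitz_space E r = {f. bdd_above ((\<lambda>v. cmod (f v - f (parent E r v))) ` (UNIV - {r}))}"

definition lipschitz_norm :: "('a \<Rightarrow> 'a \<Rightarrow> bool) \<Rightarrow> 'a \<Rightarrow> ('a \<Rightarrow> complex) \<Rightarrow> real" where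
  "lipschitz_norm E r f =
     max (cmod (f r)) (SUP v\<in>UNIV - {r}. cmod (f v - f (parent E r v)))"

text \<open>
  The filter \<open>filtercomap (level E r) at_top\<close> expresses \<open>|v| \<rightarrow> \<infinity>\<close>: a property holds
  eventually iff it holds for all \<open>v\<close> of level at least some \<open>N\<close>.
\<close>

definition little_lipschitz_space :: "('a \<Rightarrow> 'a \<Rightarrow> bool) \<Rightarrow> 'a \<Rightarrow> ('a \<Rightarrow> complex) set" where
  "little_lipschitz_space E r = {f \<in> lipschitz_space E r.
     ((\<lambda>v. cmod (f v - f (parent E r v))) \<longlongrightarrow> 0) (filtercomap (level E r) at_top)}"

definition composition_operator :: "('a \<Rightarrow> 'a) \<Rightarrow> ('a \<Rightarrow> complex) \<Rightarrow> ('a \<Rightarrow> complex)" where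
  "composition_operator \<phi> f = f \<circ> \<phi>"

text \<open>
  Operators on a linear space \<open>X\<close> of complex-valued functions with norm \<open>N\<close>; addition and
  scalar multiplication in \<open>X\<close> are pointwise.
\<close>

definition bounded_operator_on ::
  "('a \<Rightarrow> complex) set \<Rightarrow> (('a \<Rightarrow> complex) \<Rightarrow> real) \<Rightarrow>
    (('a \<Rightarrow> complex) \<Rightarrow> ('a \<Rightarrow> complex)) \<Rightarrow> bool" where
  "bounded_operator_on X N A \<longleftrightarrow>
     (\<forall>f\<in>X. A f \<in> X) \<and>
     (\<forall>f\<in>X. \<forall>g\<in>X. A (\<lambda>v. f v + g v) = (\<lambda>v. A f v + A g v)) \<and>
     (\<forall>c. \<forall>f\<in>X. A (\<lambda>v. c * f v) = (\<lambda>v. c * A f v)) \<and>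
     (\<exists>K. \<forall>f\<in>X. N (A f) \<le> K * N f)"

definition point_spectrum_on ::
  "('a \<Rightarrow> complex) set \<Rightarrow> (('a \<Rightarrow> complex) \<Rightarrow> ('a \<Rightarrow> complex)) \<Rightarrow> complex set" where
  "point_spectrum_on X A = {z. \<exists>f\<in>X. f \<noteq> (\<lambda>v. 0) \<and> A f = (\<lambda>v. z * f v)}"

end

theory Submission
  imports Defs
begin

text \<open>
  The constant function \<open>1\<close> has eigenvalue \<open>1\<close>. For \<open>\<bar>z\<bar> < 1\<close> choose \<open>w\<close> outside the range of
  \<open>\<phi>\<close>. By injectivity the points \<open>\<phi>\<^sup>n w\<close> are distinct, so one may put \<open>f (\<phi>\<^sup>n w) = z\<^sup>n\<close> and
  \<open>f = 0\<close> off the orbit of \<open>w\<close>; then \<open>f \<circ> \<phi> = z f\<close>. Only finitely many values of \<open>f\<close> exceed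
  a given \<open>\<epsilon>\<close>, and as every vertex has finitely many children, the same is true of
  the differences \<open>f v - f (v\<^sup>-)\<close>.
\<close>

text \<open>Induction strips the common first vertex. If the second vertices differed, following one
  path up to its first vertex on the other and returning along the other would give a cycle through
  \<open>u\<close>.\<close>

lemma path_between_unique:
  assumes sym: "symp E" and acyclic: "\<nexists>c. graph_cycle E c"
    and "path_between E u p v" "path_between E u q v"
  shows "p = q"
  using assms(3,4)
proof (induction p arbitrary: u q)
  case Nil
  then show ?case by (simp add: path_between_def)
next
  case (Cons x p')
  have u: "x = u" using Cons.prems by (simp add: path_between_def)
  obtain q' where q: "q = u # q'"
    using Cons.prems(2) by (cases q) (auto simp: path_between_def)
  show ?case
  proof (cases "p' = [] \<or> q' = []")
    case True
    \<comment> \<open>An empty tail means \<open>u = v\<close>, and a distinct list that begins and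
      ends with \<open>u\<close> is \<open>[u]\<close>.\<close>
    then show ?thesis
      using Cons.prems u q by (auto simp: path_between_def split: if_splits)
  next
    case False
    have p': "distinct p'" "u \<notin> set p'" "successively E p'" "E u (hd p')" "last p' = v"
      using Cons.prems(1) False u by (auto simp: path_between_def successively_Cons)
    have q': "distinct q'" "u \<notin> set q'" "successively E q'" "E u (hd q')" "last q' = v"
      using Cons.prems(2) False q by (auto simp: path_between_def successively_Cons)
    have "hd p' = hd q'"
    proof (rule ccontr)
      assume ne: "hd p' \<noteq> hd q'"
      have "\<exists>y\<in>set p'. y \<in> set q'"
        using p'(5) q'(5) False last_in_set by metis
      \<comment> \<open>Taking the first common vertex \<open>y\<close> keeps \<open>p1\<close>
        disjoint from \<open>q'\<close>, so the cycle below has no repetition.\<close>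
      then obtain p1 y p2 where p1: "p' = p1 @ y # p2" "y \<in> set q'" "\<forall>t\<in>set p1. t \<notin> set q'"
        using split_list_first_prop[of p' "\<lambda>y. y \<in> set q'"] by blast
      obtain q1 q2 where q1: "q' = q1 @ y # q2"
        using p1(2) split_list by metis
      let ?c = "u # p1 @ y # rev q1"
      \<comment> \<open>If both were empty, \<open>p'\<close> and \<open>q'\<close> would both start
        with \<open>y\<close>.\<close>
      have "p1 \<noteq> [] \<or> q1 \<noteq> []" using ne p1 q1 by auto
      then have "length ?c \<ge> 3" by (cases p1; cases q1) auto
      moreover have "distinct ?c" using p' q' p1 q1 by auto
      moreover have "successively E ?c"
      proof -
        have flip: "(\<lambda>a b. E b a) = E" using sym by (auto simp: fun_eq_iff dest: sympD)
        have "successively E (q1 @ [y])"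
          using q'(3) by (auto simp: q1 successively_append_iff)
        then have "successively E (rev (q1 @ [y]))"
          by (simp only: successively_rev flip)
        then have "successively E (y # rev q1)" by simp
        moreover have "successively E (u # p1 @ [y])"
          using p'(3,4) by (auto simp: p1 successively_Cons successively_append_iff hd_append)
        ultimately show ?thesis
          by (auto simp: successively_Cons successively_append_iff hd_append)
      qed
      \<comment> \<open>The last vertex of the cycle is \<open>hd q'\<close>, which is
        \<open>y\<close> itself when \<open>q1\<close> is empty.\<close>
      moreover have "E (last ?c) (hd ?c)"
        using sympD[OF sym q'(4)] by (cases q1) (auto simp: q1)
      ultimately show False using acyclic unfolding graph_cycle_def by blast
    qed
    then have "path_between E (hd p') p' v" "path_between E (hd p') q' v"
      using p' q' False by (auto simp: path_between_def)
    then show ?thesis using Cons.IH u q by blast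
  qed
qed

lemma path_between_the_path:
  assumes "graph_tree E"
  shows "path_between E u (the_path E u v) v"
  unfolding the_path_def
proof (rule theI')
  show "\<exists>!p. path_between E u p v"
    using assms path_between_unique
    unfolding graph_tree_def graph_connected_def simple_graph_def by metis
qed

text \<open>The last vertex before \<open>v\<close> on the path from \<open>r\<close> is a neighbor
  of \<open>v\<close>. A second neighbor on that path would close a cycle, so the description
  defining \<open>parent\<close> has exactly one solution.\<close>

lemma parent_in_neighbors:
  assumes tree: "graph_tree E" and "v \<noteq> r"
  shows "parent E r v \<in> neighbors E v"
proof -
  have sym: "symp E" and irr: "irreflp E" and acyclic: "\<nexists>c. graph_cycle E c"
    using tree by (auto simp: graph_tree_def simple_graph_def)
  define p where "p = the_path E r v"
  have p: "p \<noteq> []" "hd p = r" "last p = v" "successively E p" "distinct p"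
    using path_between_the_path[OF tree, of r v] by (auto simp: p_def path_between_def)
  obtain p' where p': "p = p' @ [v]"
    using p append_butlast_last_id by metis
  have "p' \<noteq> []" using p p' \<open>v \<noteq> r\<close> by auto
  then have Ev: "E (last p') v" using p by (auto simp: p' successively_append_iff)
  have "w = last p'" if w: "w \<in> neighbors E v" "w \<in> set p" for w
  proof (rule ccontr)
    assume ne: "w \<noteq> last p'"
    have "E v w" using w by (simp add: neighbors_def)
    then have "w \<noteq> v" using irr by (auto dest: irreflpD)
    then obtain p1 p2 where p2: "p' = p1 @ w # p2"
      using w p' split_list[of w p'] by auto
    have "p2 \<noteq> []" using ne p2 by auto
    then have "graph_cycle E (w # p2 @ [v])"
      using p \<open>E v w\<close> by (cases p2) (auto simp: p' p2 graph_cycle_def successively_append_iff)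
    then show False using acyclic by blast
  qed
  moreover have "last p' \<in> neighbors E v" "last p' \<in> set p"
    using sympD[OF sym Ev] \<open>p' \<noteq> []\<close> by (auto simp: neighbors_def p')
  ultimately have "\<exists>!w. w \<in> neighbors E v \<and> w \<in> set p" by blast
  from theI'[OF this] show ?thesis by (simp add: parent_def p_def)
qed

lemma little_lipschitzI:
  assumes tree: "graph_tree E" and lf: "locally_finite_graph E"
    and bd: "\<And>v. cmod (f v) \<le> B"
    and fin: "\<And>e. e > 0 \<Longrightarrow> finite {v. cmod (f v) \<ge> e}"
  shows "f \<in> little_lipschitz_space E r"
proof -
  have sym: "symp E" using tree by (auto simp: graph_tree_def simple_graph_def)
  have "cmod (f v - f (parent E r v)) \<le> B + B" for v
    using norm_triangle_ineq4[of "f v" "f (parent E r v)"] bd[of v] bd[of "parent E r v"]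
    by linarith
  then have "f \<in> lipschitz_space E r"
    unfolding lipschitz_space_def bdd_above_def by blast
  moreover have "((\<lambda>v. cmod (f v - f (parent E r v))) \<longlongrightarrow> 0) (filtercomap (level E r) at_top)"
  proof (rule tendstoI)
    fix e :: real assume "e > 0"
    define A where "A = {v. cmod (f v) \<ge> e / 2}"
    \<comment> \<open>A difference of size at least \<open>e\<close> needs \<open>v\<close> or its
      parent in \<open>A\<close>, that is, \<open>v\<close> in \<open>A\<close> or adjacent to a
      vertex of \<open>A\<close>. The root is added because its parent is unspecified.\<close>
    define S where "S = insert r (A \<union> (\<Union>w\<in>A. neighbors E w))"
    have "finite A" using fin[of "e / 2"] \<open>e > 0\<close> by (simp add: A_def)
    then have "finite S" using lf by (auto simp: S_def locally_finite_graph_def)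
    have small: "cmod (f v - f (parent E r v)) < e" if "v \<notin> S" for v
    proof -
      have "v \<noteq> r" "v \<notin> A" using that by (auto simp: S_def)
      then have "v \<in> neighbors E (parent E r v)"
        using parent_in_neighbors[OF tree, of v r] sym
        by (auto simp: neighbors_def dest: sympD)
      then have "parent E r v \<notin> A" using that by (auto simp: S_def)
      with \<open>v \<notin> A\<close> show ?thesis
        using norm_triangle_ineq4[of "f v" "f (parent E r v)"] by (auto simp: A_def)
    qed
    \<comment> \<open>The level is bounded on the finite set \<open>S\<close>, so all vertices of
      large level avoid it.\<close>
    have far: "v \<notin> S" if "level E r v \<ge> Suc (Max (level E r ` S))" for v
      using that \<open>finite S\<close> Max_ge[of "level E r ` S" "level E r v"] by fastforce
    have "eventually (\<lambda>n. \<forall>v. level E r v = n \<longrightarrow> v \<notin> S) at_top"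
      using far by (auto simp: eventually_at_top_linorder)
    then show "\<forall>\<^sub>F v in filtercomap (level E r) at_top.
        dist (cmod (f v - f (parent E r v))) 0 < e"
      unfolding eventually_filtercomap using small by (auto intro!: exI)
  qed
  ultimately show ?thesis by (simp add: little_lipschitz_space_def)
qed

text \<open>Cancelling \<phi> on both sides of a coincidence leaves \<open>w\<close> equal to some
  iterate of itself; a positive exponent would put \<open>w\<close> in the range.\<close>

lemma inj_orbit_outside_range:
  assumes "inj \<phi>" "w \<notin> range \<phi>"
  shows "inj (\<lambda>n. (\<phi> ^^ n) w)"
proof -
  have "m = n" if "(\<phi> ^^ m) w = (\<phi> ^^ n) w" for m n
    using that
  proof (induction m arbitrary: n)
    case 0
    then show ?case using assms(2) by (cases n) auto
  next
    case (Suc m)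
    have "\<phi> ((\<phi> ^^ m) w) \<noteq> w" using assms(2) by (metis rangeI)
    with Suc.prems obtain k where k: "n = Suc k" by (cases n) auto
    with Suc.prems have "(\<phi> ^^ m) w = (\<phi> ^^ k) w" using injD[OF assms(1)] by simp
    with Suc.IH k show ?case by simp
  qed
  then show ?thesis by (auto intro: injI)
qed

text \<open>The eigenfunction for \<open>z\<close>. The exponent is well defined when the orbit of
  \<open>w\<close> has no repetition, as in the context below. For \<open>z = 0\<close> this is the
  indicator function of \<open>w\<close>, since \<open>0 ^ 0 = 1\<close>.\<close>

definition orbit_power :: "('a \<Rightarrow> 'a) \<Rightarrow> 'a \<Rightarrow> complex \<Rightarrow> 'a \<Rightarrow> complex" where
  "orbit_power \<phi> w z v =
     (if v \<in> range (\<lambda>n. (\<phi> ^^ n) w) then z ^ (THE n. v = (\<phi> ^^ n) w) else 0)"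

lemma orbit_power_outside: "(\<And>n. v \<noteq> (\<phi> ^^ n) w) \<Longrightarrow> orbit_power \<phi> w z v = 0"
  by (auto simp: orbit_power_def)

context
  fixes \<phi> :: "'a \<Rightarrow> 'a" and w :: 'a
  assumes inj: "inj \<phi>" and w: "w \<notin> range \<phi>"
begin

lemma orbit_power_orbit: "orbit_power \<phi> w z ((\<phi> ^^ n) w) = z ^ n"
proof -
  have "(THE m. (\<phi> ^^ n) w = (\<phi> ^^ m) w) = n"
    using injD[OF inj_orbit_outside_range[OF inj w]] by (intro the_equality) auto
  then show ?thesis by (simp add: orbit_power_def)
qed

lemma orbit_power_comp: "orbit_power \<phi> w z (\<phi> v) = z * orbit_power \<phi> w z v"
proof (cases "\<exists>n. v = (\<phi> ^^ n) w")
  case True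
  then obtain n where "v = (\<phi> ^^ n) w" by blast
  then show ?thesis using orbit_power_orbit[of z n] orbit_power_orbit[of z "Suc n"] by simp
next
  case False
  \<comment> \<open>For \<open>n = 0\<close> this holds because \<open>w\<close> is outside the
    range; for \<open>n = Suc k\<close>, injectivity would give
    \<open>v = (\<phi> ^^ k) w\<close>.\<close>
  have "\<phi> v \<noteq> (\<phi> ^^ n) w" for n
    using False w injD[OF inj] by (cases n) auto
  with False show ?thesis by (simp add: orbit_power_outside)
qed

lemma cmod_orbit_power_le_1:
  assumes "cmod z \<le> 1"
  shows "cmod (orbit_power \<phi> w z v) \<le> 1"
  using assms by (auto simp: orbit_power_def norm_power power_le_one)

text \<open>The powers of \<open>cmod z\<close> tend to 0, so a value of modulus at least
  \<open>e\<close> occurs only at one of the first \<open>N\<close> orbit points.\<close>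

lemma finite_orbit_power_ge:
  assumes "cmod z < 1" "e > 0"
  shows "finite {v. cmod (orbit_power \<phi> w z v) \<ge> e}"
proof -
  have "(\<lambda>n. cmod z ^ n) \<longlonglongrightarrow> 0" using assms by (intro LIMSEQ_power_zero) auto
  then have "\<forall>\<^sub>F n in sequentially. cmod z ^ n < e" using \<open>e > 0\<close> by (rule order_tendstoD)
  then obtain N where N: "\<And>n. n \<ge> N \<Longrightarrow> cmod z ^ n < e"
    by (auto simp: eventually_sequentially)
  have "v \<in> (\<lambda>n. (\<phi> ^^ n) w) ` {..<N}" if v: "cmod (orbit_power \<phi> w z v) \<ge> e" for v
  proof -
    obtain n where n: "v = (\<phi> ^^ n) w"
      using v \<open>e > 0\<close> orbit_power_outside[of v \<phi> w z] by fastforce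
    then have "n < N"
      using v N[of n] by (auto simp: orbit_power_orbit norm_power not_le[symmetric])
    with n show ?thesis by blast
  qed
  then show ?thesis by (intro finite_subset[OF _ finite_imageI[OF finite_lessThan]]) blast
qed

end

theorem theorem4p1:
  fixes E :: "'a \<Rightarrow> 'a \<Rightarrow> bool" and r :: 'a and \<phi> :: "'a \<Rightarrow> 'a"
  assumes "infinite (UNIV :: 'a set)"
    and "graph_tree E"
    and "locally_finite_graph E"
    and "\<forall>v. v \<noteq> r \<longrightarrow> vertex_degree E v > 1"
    and "inj \<phi>"
    and "\<not> surj \<phi>"
    and "bounded_operator_on (little_lipschitz_space E r) (lipschitz_norm E r)
           (composition_operator \<phi>)"
  shows "{1} \<union> ball 0 1 \<subseteq>
           point_spectrum_on (little_lipschitz_space E r) (composition_operator \<phi>)"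
proof
  fix z :: complex
  assume "z \<in> {1} \<union> ball 0 1"
  then consider "z = 1" | "cmod z < 1" by auto
  then show "z \<in> point_spectrum_on (little_lipschitz_space E r) (composition_operator \<phi>)"
  proof cases
    case 1
    have "(\<lambda>v. 1) \<in> little_lipschitz_space E r"
      by (auto simp: little_lipschitz_space_def lipschitz_space_def)
    moreover have "(\<lambda>v::'a. 1::complex) \<noteq> (\<lambda>v. 0)" by (simp add: fun_eq_iff)
    ultimately show ?thesis
      using 1 by (auto simp: point_spectrum_on_def composition_operator_def comp_def)
  next
    case 2
    obtain w where w: "w \<notin> range \<phi>" using \<open>\<not> surj \<phi>\<close> by auto
    let ?f = "orbit_power \<phi> w z"
    note orb = \<open>inj \<phi>\<close> w
    have "?f \<in> little_lipschitz_space E r"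
      using 2 by (intro little_lipschitzI[OF assms(2,3), of _ 1])
        (auto intro: cmod_orbit_power_le_1[OF orb] finite_orbit_power_ge[OF orb])
    \<comment> \<open>The orbit point with exponent 0 is \<open>w\<close>, where the value is 1 even
      for \<open>z = 0\<close>; this makes \<open>?f\<close> nonzero.\<close>
    moreover have "?f w = 1" using orbit_power_orbit[OF orb, of z 0] by simp
    then have "?f \<noteq> (\<lambda>v. 0)" by (metis zero_neq_one)
    moreover have "composition_operator \<phi> ?f = (\<lambda>v. z * ?f v)"
      by (auto simp: composition_operator_def fun_eq_iff orbit_power_comp[OF orb])
    ultimately show ?thesis unfolding point_spectrum_on_def by blast
  qed
qed

end
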